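(* Let $\dot x=f(x,u)$ be an unknown control system whose dynamics $f$ is modeled by the Gaussian process posterior $f\sim\mathcal N(\mu,\Sigma)$, and let the barrier states dynamics be $$f^z(x,z,u)=\mathcal B(x,z)f(x,u)-\gamma\big(z+\beta_0-B(h(x))\big)$$ (all as defined in the context). Then the barrier states dynamics $f^z$ are Gaussian processes, and are thus completely defined by their mean and variance, which, with $\hat x=(x,u)$, are $$\mathbb E[f^z\mid\hat x]=\mu^z=\mathcal B(x,z)\,\mathbb E[f(x,u)\mid\hat x]-\gamma\big(z+\beta_0-B(h(x))\big),$$ $$\mathbb V[f^z\mid\hat x]=\Sigma^z=\mathcal B(x,z)\,\mathbb V[f(x,u)\mid\hat x]\,\mathcal B(x,z)^{\mathsf T}.$$
   Context: System: $\dot x=f(x,u)$ with $x\in\mathcal X\subset\mathbb R^n$, $u\in\mathcal U\subset\mathbb R^m$. $h$ is a continuously differentiable real function defining the safe set $\mathcal S=\{x: h(x)>0\}$. Barrier state: $B$ is a barrier function on $(0,\infty)$ (smooth, invertible, $B(\eta)\to+\infty$ as $\eta\to0^+$); $\beta(x)=B(h(x))$, $\beta_0=\beta(0)$, $\gamma\ge0$ is a constant, and the barrier state is $z=\beta(x)-\beta(0)$. We set $\mathcal B(x,z)=B'\big(B^{-1}(z+\beta_0)\big)h_x(x)$, where $h_x$ is the gradient (row vector) of $h$. If several barrier states $z=(z_1,\dots,z_q)$ are used, each is defined in this way and the equations are stacked, with $\mathcal B(x,z)$ then having $q$ rows. Gaussian process model: write $\hat x=(x,u)$. Given training inputs $\hat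 X$ with outputs $F$ (values of $f$), kernel ${\rm K}$, noise variance $\sigma_n^2$, a zero prior mean, and $\mathbf K={\rm K}(\hat X,\hat X)+\sigma_n^2 I$, the posterior model of $f$ is a Gaussian process, $f\sim\mathcal N(\mu,\Sigma)$, with $$\mathbb E[f]=\mu(\hat x)={\rm K}(\hat x,\hat X)\mathbf K^{-1}F,\qquad \mathbb V[f]=\Sigma(\hat x)={\rm K}(\hat x,\hat x)-{\rm K}(\hat x,\hat X)\mathbf K^{-1}{\rm K}(\hat X,\hat x).$$ The values $x$, $u$ (and $z$) are known (deterministic) at the point where $f^z$ is evaluated; the randomness is only that of $f$. *)

theory Defs
  imports "HOL-Probability.Probability"
begin

subsection \<open>Gaussian processes with values in a Euclidean space\<close>

text \<open>
  The normal law with variance zero is the point mass. It has to be admitted: a posterior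
  variance may be singular, and so may a linear image of a nonsingular one.
\<close>

definition normal_rv :: "'a measure \<Rightarrow> ('a \<Rightarrow> real) \<Rightarrow> bool" where
  "normal_rv M X \<longleftrightarrow>
     X \<in> borel_measurable M \<and>
     (\<exists>m. (AE \<omega> in M. X \<omega> = m) \<or>
          (\<exists>\<sigma>>0. distributed M lborel X (normal_density m \<sigma>)))"

text \<open>
  Joint normality (possibly degenerate) of the finitely many random vectors \<open>X t\<close>,
  \<open>t \<in> J\<close>: every linear combination of all their coordinates is normal.
\<close>

definition jointly_gaussian :: "'a measure \<Rightarrow> 'i set \<Rightarrow> ('i \<Rightarrow> 'a \<Rightarrow> real ^ 'd) \<Rightarrow> bool" where
  "jointly_gaussian M J X \<longleftrightarrow>
     (\<forall>t\<in>J. X t \<in> borel_measurable M) \<and>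
     (\<forall>c :: 'i \<Rightarrow> real ^ 'd. normal_rv M (\<lambda>\<omega>. \<Sum>t\<in>J. c t \<bullet> X t \<omega>))"

definition gaussian_process :: "'a measure \<Rightarrow> 'i set \<Rightarrow> ('i \<Rightarrow> 'a \<Rightarrow> real ^ 'd) \<Rightarrow> bool" where
  "gaussian_process M T X \<longleftrightarrow>
     prob_space M \<and> (\<forall>J. finite J \<and> J \<subseteq> T \<longrightarrow> jointly_gaussian M J X)"

definition mean_vec :: "'a measure \<Rightarrow> ('a \<Rightarrow> real ^ 'd) \<Rightarrow> real ^ 'd" where
  "mean_vec M X = (\<integral>\<omega>. X \<omega> \<partial>M)"

definition cov_mat :: "'a measure \<Rightarrow> ('a \<Rightarrow> real ^ 'd) \<Rightarrow> ('a \<Rightarrow> real ^ 'e) \<Rightarrow> real ^ 'e ^ 'd" where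
  "cov_mat M X Y =
     (\<chi> i j. \<integral>\<omega>. (X \<omega> $ i - mean_vec M X $ i) * (Y \<omega> $ j - mean_vec M Y $ j) \<partial>M)"

abbreviation var_mat :: "'a measure \<Rightarrow> ('a \<Rightarrow> real ^ 'd) \<Rightarrow> real ^ 'd ^ 'd" where
  "var_mat M X \<equiv> cov_mat M X X"

definition fin_dim_law ::
  "'a measure \<Rightarrow> 'i set \<Rightarrow> ('i \<Rightarrow> 'a \<Rightarrow> real ^ 'd) \<Rightarrow> ('i \<Rightarrow> real ^ 'd) measure" where
  "fin_dim_law M J X = distr M (\<Pi>\<^sub>M t\<in>J. borel) (\<lambda>\<omega>. \<lambda>t\<in>J. X t \<omega>)"


subsection \<open>The posterior of Gaussian process regression\<close>

text \<open>
  The regressed function has values in \<open>real ^ 'n\<close>, so the kernel is matrix valued; a scalar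
  kernel \<open>k\<close> is the case \<open>K a b = k a b *\<^sub>R mat 1\<close>. The training points are indexed
  by \<open>'d\<close>, and stacking the outputs over all of them gives vectors indexed by \<open>'d \<times> 'n\<close>.
\<close>

definition psd_kernel :: "'p set \<Rightarrow> ('p \<Rightarrow> 'p \<Rightarrow> real ^ 'n ^ 'n) \<Rightarrow> bool" where
  "psd_kernel D K \<longleftrightarrow>
     (\<forall>a\<in>D. \<forall>b\<in>D. K b a = transpose (K a b)) \<and>
     (\<forall>J (c :: 'p \<Rightarrow> real ^ 'n). finite J \<and> J \<subseteq> D \<longrightarrow>
        0 \<le> (\<Sum>a\<in>J. \<Sum>b\<in>J. c a \<bullet> (K a b *v c b)))"

definition stack :: "('d::finite \<Rightarrow> real ^ 'n) \<Rightarrow> real ^ ('d \<times> 'n)" where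
  "stack F = (\<chi> p. F (fst p) $ snd p)"

definition kernel_row ::
  "('p \<Rightarrow> 'p \<Rightarrow> real ^ 'n ^ 'n) \<Rightarrow> 'p \<Rightarrow> ('d::finite \<Rightarrow> 'p) \<Rightarrow> real ^ ('d \<times> 'n) ^ 'n" where
  "kernel_row K a X = (\<chi> i q. K a (X (fst q)) $ i $ snd q)"

definition kernel_col ::
  "('p \<Rightarrow> 'p \<Rightarrow> real ^ 'n ^ 'n) \<Rightarrow> ('d::finite \<Rightarrow> 'p) \<Rightarrow> 'p \<Rightarrow> real ^ 'n ^ ('d \<times> 'n)" where
  "kernel_col K X a = (\<chi> p j. K (X (fst p)) a $ snd p $ j)"

definition noisy_gram ::
  "('p \<Rightarrow> 'p \<Rightarrow> real ^ 'n ^ 'n) \<Rightarrow> ('d::finite \<Rightarrow> 'p) \<Rightarrow> real \<Rightarrow>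
     real ^ ('d \<times> 'n) ^ ('d \<times> 'n)" where
  "noisy_gram K X \<sigma>\<^sub>n =
     (\<chi> p q. K (X (fst p)) (X (fst q)) $ snd p $ snd q) + \<sigma>\<^sub>n\<^sup>2 *\<^sub>R mat 1"

definition posterior_mean ::
  "('p \<Rightarrow> 'p \<Rightarrow> real ^ 'n ^ 'n) \<Rightarrow> ('d::finite \<Rightarrow> 'p) \<Rightarrow> ('d \<Rightarrow> real ^ 'n) \<Rightarrow> real \<Rightarrow>
     'p \<Rightarrow> real ^ 'n" where
  "posterior_mean K X F \<sigma>\<^sub>n a =
     (kernel_row K a X ** matrix_inv (noisy_gram K X \<sigma>\<^sub>n)) *v stack F"

definition posterior_var ::
  "('p \<Rightarrow> 'p \<Rightarrow> real ^ 'n ^ 'n) \<Rightarrow> ('d::finite \<Rightarrow> 'p) \<Rightarrow> real \<Rightarrow> 'p \<Rightarrow> real ^ 'n ^ 'n" where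
  "posterior_var K X \<sigma>\<^sub>n a =
     K a a - kernel_row K a X ** matrix_inv (noisy_gram K X \<sigma>\<^sub>n) ** kernel_col K X a"

definition gp_posterior_model ::
  "'a measure \<Rightarrow> 'p set \<Rightarrow> ('p \<Rightarrow> 'p \<Rightarrow> real ^ 'n ^ 'n) \<Rightarrow> ('d::finite \<Rightarrow> 'p) \<Rightarrow>
     ('d \<Rightarrow> real ^ 'n) \<Rightarrow> real \<Rightarrow> ('p \<Rightarrow> 'a \<Rightarrow> real ^ 'n) \<Rightarrow> bool" where
  "gp_posterior_model M D K X F \<sigma>\<^sub>n f \<longleftrightarrow>
     psd_kernel D K \<and> range X \<subseteq> D \<and> invertible (noisy_gram K X \<sigma>\<^sub>n) \<and>
     gaussian_process M D f \<and>
     (\<forall>a\<in>D. mean_vec M (f a) = posterior_mean K X F \<sigma>\<^sub>n a \<and>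
            var_mat M (f a) = posterior_var K X \<sigma>\<^sub>n a)"


subsection \<open>Barrier states\<close>

definition barrier_function :: "(real \<Rightarrow> real) \<Rightarrow> bool" where
  "barrier_function B \<longleftrightarrow>
     (\<forall>k. \<forall>\<eta>>0. (deriv ^^ k) B field_differentiable (at \<eta>)) \<and>
     inj_on B {0<..} \<and>
     filterlim B at_top (at_right 0)"

definition gradient :: "(real ^ 'n \<Rightarrow> real) \<Rightarrow> real ^ 'n \<Rightarrow> real ^ 'n" where
  "gradient h x = (THE g. GDERIV h x :> g)"

text \<open>The set \<open>S\<close> need not be open, so the derivative is taken on an open neighbourhood of it.\<close>

definition continuously_differentiable_near :: "(real ^ 'n) set \<Rightarrow> (real ^ 'n \<Rightarrow> real) \<Rightarrow> bool" where
  "continuously_differentiable_near S h \<longleftrightarrow>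
     (\<exists>D. open D \<and> S \<subseteq> D \<and> (\<forall>x\<in>D. \<exists>g. GDERIV h x :> g) \<and> continuous_on D (gradient h))"

text \<open>
  Barrier states are indexed by \<open>'q\<close>, each with its own barrier function \<open>B j\<close>, safety function
  \<open>h j\<close> and constant \<open>\<gamma> j\<close>.
\<close>

definition barrier_beta ::
  "('q::finite \<Rightarrow> real \<Rightarrow> real) \<Rightarrow> ('q \<Rightarrow> real ^ 'n \<Rightarrow> real) \<Rightarrow> real ^ 'n \<Rightarrow> real ^ 'q" where
  "barrier_beta B h x = (\<chi> j. B j (h j x))"

text \<open>
  The row \<open>j\<close> is the gradient of \<open>h j\<close> scaled by \<open>B'(B\<inverse>(z + \<beta>\<^sub>0))\<close>, where the
  inverse is that of \<open>B j\<close> restricted to the positive reals.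
\<close>

definition barrier_matrix ::
  "('q::finite \<Rightarrow> real \<Rightarrow> real) \<Rightarrow> ('q \<Rightarrow> real ^ 'n \<Rightarrow> real) \<Rightarrow> real ^ 'n \<Rightarrow> real ^ 'q \<Rightarrow>
     real ^ 'n ^ 'q" where
  "barrier_matrix B h x z =
     (\<chi> j. deriv (B j) (inv_into {0<..} (B j) (z $ j + barrier_beta B h 0 $ j)) *\<^sub>R gradient (h j) x)"

definition barrier_decay ::
  "('q::finite \<Rightarrow> real \<Rightarrow> real) \<Rightarrow> ('q \<Rightarrow> real ^ 'n \<Rightarrow> real) \<Rightarrow> ('q \<Rightarrow> real) \<Rightarrow>
     real ^ 'n \<Rightarrow> real ^ 'q \<Rightarrow> real ^ 'q" where
  "barrier_decay B h \<gamma> x z = (\<chi> j. \<gamma> j * (z $ j + barrier_beta B h 0 $ j - B j (h j x)))"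

definition barrier_dynamics ::
  "('q::finite \<Rightarrow> real \<Rightarrow> real) \<Rightarrow> ('q \<Rightarrow> real ^ 'n \<Rightarrow> real) \<Rightarrow> ('q \<Rightarrow> real) \<Rightarrow>
     ((real ^ 'n) \<times> (real ^ 'm) \<Rightarrow> 'a \<Rightarrow> real ^ 'n) \<Rightarrow>
     (real ^ 'n) \<times> (real ^ 'q) \<times> (real ^ 'm) \<Rightarrow> 'a \<Rightarrow> real ^ 'q" where
  "barrier_dynamics B h \<gamma> f =
     (\<lambda>(x, z, u) \<omega>. barrier_matrix B h x z *v f (x, u) \<omega> - barrier_decay B h \<gamma> x z)"

text \<open>The points at which \<open>B j (h j x)\<close> and the inverse in \<open>barrier_matrix\<close> are meaningful.\<close>

definition barrier_domain ::
  "(real ^ 'n) set \<Rightarrow> (real ^ 'm) set \<Rightarrow> ('q::finite \<Rightarrow> real \<Rightarrow> real) \<Rightarrow>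
     ('q \<Rightarrow> real ^ 'n \<Rightarrow> real) \<Rightarrow> ((real ^ 'n) \<times> (real ^ 'q) \<times> (real ^ 'm)) set" where
  "barrier_domain \<X> \<U> B h =
     {(x, z, u). x \<in> \<X> \<and> u \<in> \<U> \<and>
        (\<forall>j. h j x > 0 \<and> z $ j + barrier_beta B h 0 $ j \<in> B j ` {0<..})}"

end

theory Submission
  imports Defs
begin

text \<open>
  An affine image of a Gaussian process is a Gaussian process, whose mean and variance follow from
  linearity of the expectation. That mean and covariance determine the finite-dimensional laws is
  the Cramer-Wold argument: they determine the (normal) laws of all linear combinations of the
  coordinates, hence the joint characteristic function, hence the joint law. The last step reduces
  to Levy's uniqueness theorem on the real line, replacing one coordinate at a time in the
  integral of a product of exponentials by the indicator of a Borel set.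
\<close>

section \<open>Uniqueness of finite measures on the line, and of weighted laws\<close>

text \<open>Levy's theorem concerns probability distributions. The value of a characteristic
  function at 0 is the total mass, so both masses agree; either both measures vanish, or dividing by
  the common mass \<open>r\<close> reduces to the probability case. Finite rather than probability
  measures are wanted because the later arguments restrict measures to events and reweight
  them.\<close>

lemma finite_measure_eq_if_char_eq:
  fixes M N :: "real measure"
  assumes M: "finite_measure M" "sets M = sets borel"
    and N: "finite_measure N" "sets N = sets borel"
    and char: "char M = char N"
  shows "M = N"
proof -
  interpret M: finite_measure M by fact
  interpret N: finite_measure N by fact
  have sp: "space M = UNIV" "space N = UNIV"
    using sets_eq_imp_space_eq[OF M(2)] sets_eq_imp_space_eq[OF N(2)] by auto
  have mass: "measure M UNIV = measure N UNIV"
    using fun_cong[OF char, of 0] by (simp add: char_def sp)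
  define r where "r = measure M UNIV"
  show ?thesis
  proof (cases "r = 0")
    case True
    have "emeasure M A = 0" "emeasure N A = 0" if "A \<in> sets borel" for A
    proof -
      have "measure M A \<le> 0" "measure N A \<le> 0"
        using M.finite_measure_mono[of A UNIV] N.finite_measure_mono[of A UNIV] True mass
          M(2) N(2) by (auto simp: r_def)
      then show "emeasure M A = 0" "emeasure N A = 0"
        by (simp_all add: M.emeasure_eq_measure N.emeasure_eq_measure measure_le_0_iff)
    qed
    then show ?thesis
      by (intro measure_eqI) (simp_all add: M(2) N(2))
  next
    case False
    then have r: "r > 0"
      by (simp add: r_def zero_less_measure_iff)
    define nrm where "nrm L = density L (\<lambda>_. ennreal (1 / r))" for L :: "real measure"
    have nrm: "real_distribution (nrm L)" "\<And>t. char (nrm L) t = (1 / r) *\<^sub>R char L t"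
      if "finite_measure L" "sets L = sets borel" "measure L UNIV = r" for L
    proof -
      interpret finite_measure L by fact
      have spL: "space L = UNIV"
        using sets_eq_imp_space_eq[OF that(2)] by auto
      have "emeasure (nrm L) (space (nrm L)) = ennreal (1 / r) * ennreal r"
        using that(2,3) by (simp add: nrm_def emeasure_density_const spL emeasure_eq_measure)
      also have "\<dots> = 1"
        using r by (simp flip: ennreal_mult)
      finally have "prob_space (nrm L)" ..
      then show "real_distribution (nrm L)"
        using that(2) by (auto simp: real_distribution_def real_distribution_axioms_def nrm_def)
      have [measurable_cong]: "sets L = sets borel" by fact
      show "char (nrm L) t = (1 / r) *\<^sub>R char L t" for t
        unfolding char_def nrm_def using r by (subst integral_density) auto
    qed
    have "nrm M = nrm N"
      using nrm[OF M] nrm[OF N] mass char by (intro Levy_uniqueness) (auto simp: r_def)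
    then have eq: "ennreal (1 / r) * emeasure M A = ennreal (1 / r) * emeasure N A"
      if "A \<in> sets borel" for A
      using that M(2) N(2) emeasure_density_const[of A M] emeasure_density_const[of A N]
      by (metis nrm_def)
    show ?thesis
    proof (rule measure_eqI)
      fix A assume "A \<in> sets M"
      then show "emeasure M A = emeasure N A"
        using eq[of A] r M(2) by (auto simp: ennreal_mult_cancel_left)
    qed (simp add: M(2) N(2))
  qed
qed

text \<open>The hypothesis \<open>eq\<close> says that the images under \<open>Y\<close> and
  \<open>Y'\<close> of the measures with densities \<open>w\<close> and \<open>w'\<close> have the
  same characteristic function. These images are finite measures because the weights are nonnegative
  and integrable, so they coincide, and the conclusion compares their values on
  \<open>A\<close>.\<close>

lemma weighted_integral_eq_if_char_eq:
  fixes Y w :: "'a \<Rightarrow> real" and Y' w' :: "'b \<Rightarrow> real"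
  assumes M: "finite_measure M" and N: "finite_measure N"
    and Y[measurable]: "Y \<in> borel_measurable M" "Y' \<in> borel_measurable N"
    and w: "integrable M w" "integrable N w'" "\<And>x. 0 \<le> w x" "\<And>x. 0 \<le> w' x"
    and eq: "\<And>s. (\<integral>x. w x *\<^sub>R iexp (s * Y x) \<partial>M) = (\<integral>x. w' x *\<^sub>R iexp (s * Y' x) \<partial>N)"
    and A[measurable]: "A \<in> sets borel"
  shows "(\<integral>x. w x * indicator A (Y x) \<partial>M) = (\<integral>x. w' x * indicator A (Y' x) \<partial>N)"
proof -
  \<comment> \<open>Stated for an arbitrary space, so that it can be instantiated on both sides,
    which have different types.\<close>
  have dist: "finite_measure (distr (density L v) borel Z)"
      "\<And>s. char (distr (density L v) borel Z) s = (\<integral>x. v x *\<^sub>R iexp (s * Z x) \<partial>L)"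
      "measure (distr (density L v) borel Z) A = (\<integral>x. v x * indicator A (Z x) \<partial>L)"
    if Z[measurable]: "Z \<in> borel_measurable L" and v: "integrable L v" "\<And>x. 0 \<le> v x"
    for L :: "'c measure" and Z v :: "'c \<Rightarrow> real"
  proof -
    have [measurable]: "v \<in> borel_measurable L"
      using v(1) by simp
    have "emeasure (density L v) (space L) \<noteq> \<infinity>"
      using v by (simp add: emeasure_density nn_integral_eq_integral cong: nn_integral_cong)
    then have fin: "finite_measure (density L v)"
      by (intro finite_measureI) simp
    then show "finite_measure (distr (density L v) borel Z)"
      by (rule finite_measure.finite_measure_distr) simp
    show "char (distr (density L v) borel Z) s = (\<integral>x. v x *\<^sub>R iexp (s * Z x) \<partial>L)" for s
      unfolding char_def using v by (simp add: integral_distr integral_density)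
    interpret D: finite_measure "distr (density L v) borel Z" by fact
    have "measure (distr (density L v) borel Z) A =
        (\<integral>x. indicator A x \<partial>distr (density L v) borel Z)"
      by simp
    also have "\<dots> = (\<integral>x. v x * indicator A (Z x) \<partial>L)"
      using v by (subst integral_distr) (auto simp: integral_density)
    finally show "measure (distr (density L v) borel Z) A = (\<integral>x. v x * indicator A (Z x) \<partial>L)" .
  qed
  have "distr (density M w) borel Y = distr (density N w') borel Y'"
    using dist[OF Y(1) w(1,3)] dist[OF Y(2) w(2,4)] eq
    by (intro finite_measure_eq_if_char_eq ext) auto
  then show ?thesis
    using dist(3)[OF Y(1) w(1,3)] dist(3)[OF Y(2) w(2,4)] by simp
qed

text \<open>
  A complex weight \<open>iexp Z\<close> is recovered from the nonnegative weights \<open>1 + cos (Z + u)\<close>, to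
  which the one-dimensional uniqueness theorem applies.
\<close>

lemma indicator_iexp_integral_eq_if_char_eq:
  fixes Y Z :: "'a \<Rightarrow> real" and Y' Z' :: "'b \<Rightarrow> real"
  assumes M: "finite_measure M" and N: "finite_measure N"
    and meas[measurable]: "Y \<in> borel_measurable M" "Z \<in> borel_measurable M"
      "Y' \<in> borel_measurable N" "Z' \<in> borel_measurable N"
    and eq: "\<And>s t. (\<integral>x. iexp (s * Y x + t * Z x) \<partial>M) = (\<integral>x. iexp (s * Y' x + t * Z' x) \<partial>N)"
    and A[measurable]: "A \<in> sets borel"
  shows "(\<integral>x. indicator A (Y x) *\<^sub>R iexp (Z x) \<partial>M) = (\<integral>x. indicator A (Y' x) *\<^sub>R iexp (Z' x) \<partial>N)"
proof -
  \<comment> \<open>The bound 2 is the maximum of \<open>1 + cos\<close>; it also covers the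
    functions of modulus at most 1 below.\<close>
  have int: "integrable L f" if "finite_measure L" "f \<in> borel_measurable L" "\<And>x. norm (f x) \<le> 2"
    for f :: "'c \<Rightarrow> 'd :: {banach, second_countable_topology}" and L
    using that by (intro finite_measure.integrable_const_bound[of L _ 2]) auto
  have nb: "norm (iexp a) \<le> 2" for a by simp
  have cb: "0 \<le> 1 + cos a" "\<bar>1 + cos a\<bar> \<le> 2" for a :: real
    using cos_ge_minus_one[of a] cos_le_one[of a] by linarith+
  \<comment> \<open>By Euler's formula the cosine is the mean of two exponentials, so the weighted
    integral is a combination of joint characteristic function values at \<open>t = 0\<close>,
    \<open>1\<close> and \<open>-1\<close>. The factors \<open>0\<close>, \<open>1\<close> and
    \<open>- 1\<close> are kept unsimplified to match the form of \<open>eq\<close>.\<close>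
  have split: "(\<integral>x. (1 + cos (V x + u)) *\<^sub>R iexp (s * W x) \<partial>L) =
      (\<integral>x. iexp (s * W x + 0 * V x) \<partial>L) + iexp u / 2 * (\<integral>x. iexp (s * W x + 1 * V x) \<partial>L)
        + iexp (- u) / 2 * (\<integral>x. iexp (s * W x + (- 1) * V x) \<partial>L)"
    if L: "finite_measure L" and [measurable]: "V \<in> borel_measurable L" "W \<in> borel_measurable L"
    for L :: "'c measure" and V W u s
  proof -
    have "(\<integral>x. (1 + cos (V x + u)) *\<^sub>R iexp (s * W x) \<partial>L) =
        (\<integral>x. iexp (s * W x + 0 * V x) + iexp u / 2 * iexp (s * W x + 1 * V x)
           + iexp (- u) / 2 * iexp (s * W x + (- 1) * V x) \<partial>L)"
    proof (intro Bochner_Integration.integral_cong refl)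
      fix x
      have c: "complex_of_real (cos (V x + u)) = (iexp (V x + u) + iexp (- (V x + u))) / 2"
        by (simp add: cos_of_real[symmetric] cos_exp_eq algebra_simps)
      show "(1 + cos (V x + u)) *\<^sub>R iexp (s * W x) =
          iexp (s * W x + 0 * V x) + iexp u / 2 * iexp (s * W x + 1 * V x)
            + iexp (- u) / 2 * iexp (s * W x + (- 1) * V x)"
        unfolding scaleR_conv_of_real of_real_add of_real_1 c
        by (simp add: ring_distribs exp_add exp_diff exp_minus field_simps)
    qed
    also have "\<dots> = (\<integral>x. iexp (s * W x + 0 * V x) \<partial>L) + iexp u / 2 * (\<integral>x. iexp (s * W x + 1 * V x) \<partial>L)
        + iexp (- u) / 2 * (\<integral>x. iexp (s * W x + (- 1) * V x) \<partial>L)"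
    proof -
      have i: "integrable L (\<lambda>x. iexp (s * W x + t * V x))" for t
        by (rule int[OF L _ nb]) measurable
      note j = i[of 0] i[of 1] i[of "-1"]
      show ?thesis
        by (simp only: Bochner_Integration.integral_add Bochner_Integration.integrable_add
          integral_mult_right_zero integrable_mult_right j)
    qed
    finally show ?thesis .
  qed
  have one: "(\<integral>x. 1 * indicator A (Y x) \<partial>M) = (\<integral>x. (1 :: real) * indicator A (Y' x) \<partial>N)"
    using eq[of _ 0]
    by (intro weighted_integral_eq_if_char_eq M N) (auto intro!: int M N)
  \<comment> \<open>The cosine changes sign and is no admissible weight; it is reached by
    subtracting the case of weight 1 from that of \<open>1 + cos\<close>.\<close>
  have cos: "(\<integral>x. indicator A (Y x) * cos (Z x + u) \<partial>M) = (\<integral>x. indicator A (Y' x) * cos (Z' x + u) \<partial>N)" for u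
  proof -
    have "(\<integral>x. (1 + cos (Z x + u)) * indicator A (Y x) \<partial>M) =
        (\<integral>x. (1 + cos (Z' x + u)) * indicator A (Y' x) \<partial>N)"
    proof (rule weighted_integral_eq_if_char_eq[OF M N])
      show "(\<integral>x. (1 + cos (Z x + u)) *\<^sub>R iexp (s * Y x) \<partial>M) =
          (\<integral>x. (1 + cos (Z' x + u)) *\<^sub>R iexp (s * Y' x) \<partial>N)" for s
        by (simp only: split[OF M meas(2,1)] split[OF N meas(4,3)] eq)
    qed (use cb in \<open>auto intro!: int M N\<close>)
    moreover have split1: "(\<integral>x. (1 + cos (V x + u)) * indicator A (W x) \<partial>L) =
        (\<integral>x. 1 * indicator A (W x) \<partial>L) + (\<integral>x. indicator A (W x) * cos (V x + u) \<partial>L)"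
      if L: "finite_measure L" and [measurable]: "V \<in> borel_measurable L" "W \<in> borel_measurable L"
      for L :: "'c measure" and V W
    proof (subst Bochner_Integration.integral_add[symmetric])
      show "integrable L (\<lambda>x. 1 * indicator A (W x) :: real)"
        by (rule int[OF L]) (auto simp: indicator_def)
      have "\<bar>cos a\<bar> \<le> 2" for a :: real
        using abs_cos_le_one[of a] by linarith
      then show "integrable L (\<lambda>x. indicator A (W x) * cos (V x + u))"
        by (intro int[OF L]) (auto simp: indicator_def)
    qed (simp add: algebra_simps)
    ultimately show ?thesis
      using one split1[OF M meas(2,1)] split1[OF N meas(4,3)] by simp
  qed
  \<comment> \<open>The phases \<open>0\<close> and \<open>- pi / 2\<close> give the real part and,
    since sine is a shifted cosine, the imaginary part.\<close>
  have reim: "(\<integral>x. indicator A (W x) *\<^sub>R iexp (V x) \<partial>L) =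
      Complex (\<integral>x. indicator A (W x) * cos (V x + 0) \<partial>L) (\<integral>x. indicator A (W x) * cos (V x + (- pi / 2)) \<partial>L)"
    if L: "finite_measure L" and [measurable]: "V \<in> borel_measurable L" "W \<in> borel_measurable L"
    for L :: "'c measure" and V W
  proof -
    have i: "integrable L (\<lambda>x. indicator A (W x) *\<^sub>R iexp (V x))"
      by (rule int[OF L]) (auto simp: indicator_def)
    show ?thesis
      by (rule complex_eqI)
        (simp_all add: i Re_exp Im_exp cos_diff del: scaleR_conv_of_real flip: integral_Re integral_Im)
  qed
  show ?thesis
    by (simp only: reim[OF M meas(2,1)] reim[OF N meas(4,3)] cos)
qed

section \<open>From joint characteristic functions to boxes\<close>

text \<open>Induction on the index set with the measures arbitrary: the event for one coordinate
  \<open>k\<close> is absorbed into the measures by restricting them to it, and the induction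
  hypothesis handles the remaining coordinates under the restricted measures.\<close>

lemma measure_box_eq_if_char_eq:
  fixes Y :: "'i \<Rightarrow> 'a \<Rightarrow> real" and Y' :: "'i \<Rightarrow> 'b \<Rightarrow> real"
  assumes "finite I"
    and "finite_measure M" "finite_measure N"
    and "\<And>i. i \<in> I \<Longrightarrow> Y i \<in> borel_measurable M" "\<And>i. i \<in> I \<Longrightarrow> Y' i \<in> borel_measurable N"
    and "\<And>c. (\<integral>x. iexp (\<Sum>i\<in>I. c i * Y i x) \<partial>M) = (\<integral>x. iexp (\<Sum>i\<in>I. c i * Y' i x) \<partial>N)"
    and "\<And>i. i \<in> I \<Longrightarrow> A i \<in> sets borel"
  shows "measure M {x\<in>space M. \<forall>i\<in>I. Y i x \<in> A i} = measure N {x\<in>space N. \<forall>i\<in>I. Y' i x \<in> A i}"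
  using assms
proof (induction I arbitrary: M N)
  case empty
  \<comment> \<open>With no coordinates the exponential is constantly 1, so the hypothesis equates
    the total masses.\<close>
  from empty.prems(5)[of "\<lambda>_. 0"] show ?case by simp
next
  case (insert k I)
  note M = insert.prems(1) and N = insert.prems(2)
  note [measurable] = insert.prems(3,4)
  have [measurable]: "Y k \<in> borel_measurable M" "Y' k \<in> borel_measurable N" "A k \<in> sets borel"
    using insert.prems(3-6) by auto
  have Y: "\<And>i. i \<in> I \<Longrightarrow> Y i \<in> borel_measurable M" "\<And>i. i \<in> I \<Longrightarrow> Y' i \<in> borel_measurable N"
    using insert.prems(3,4) by auto
  have sumY[measurable]: "(\<lambda>x. \<Sum>i\<in>I. c i * Y i x) \<in> borel_measurable M"
      "(\<lambda>x. \<Sum>i\<in>I. c i * Y' i x) \<in> borel_measurable N" for c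
    using Y by (auto intro!: borel_measurable_sum borel_measurable_times)
  \<comment> \<open>The restriction is not normalised: its mass is the measure of the event, which
    may be 0.\<close>
  define M' where "M' = density M (indicator {x\<in>space M. Y k x \<in> A k})"
  define N' where "N' = density N (indicator {x\<in>space N. Y' k x \<in> A k})"
  have S[measurable]: "{x\<in>space M. Y k x \<in> A k} \<in> sets M" "{x\<in>space N. Y' k x \<in> A k} \<in> sets N"
    by measurable
  have box: "{x\<in>space M. \<forall>i\<in>I. Y i x \<in> A i} \<in> sets M" "{x\<in>space N. \<forall>i\<in>I. Y' i x \<in> A i} \<in> sets N"
    using Y insert.prems(6) insert.hyps(1) by (auto intro!: sets.sets_Collect_finite_All measurable_sets_Collect)
  have "measure M' {x\<in>space M'. \<forall>i\<in>I. Y i x \<in> A i} = measure N' {x\<in>space N'. \<forall>i\<in>I. Y' i x \<in> A i}"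
  proof (rule insert.IH)
    show "finite_measure M'" "finite_measure N'"
      unfolding M'_def N'_def
      using M N S by (auto intro: finite_measure.finite_measure_restricted)
    fix c
    \<comment> \<open>One coordinate is exchanged here: \<open>Y k\<close> goes into the indicator,
      while the linear combination of the others serves as the phase \<open>Z\<close>.\<close>
    have ch: "(\<integral>x. indicator (A k) (Y k x) *\<^sub>R iexp (\<Sum>i\<in>I. c i * Y i x) \<partial>M) =
        (\<integral>x. indicator (A k) (Y' k x) *\<^sub>R iexp (\<Sum>i\<in>I. c i * Y' i x) \<partial>N)"
    proof (rule indicator_iexp_integral_eq_if_char_eq[OF M N])
      fix s t
      \<comment> \<open>Coefficient \<open>s\<close> at \<open>k\<close> and \<open>t * c i\<close>
        elsewhere; since \<open>k\<close> is not in \<open>I\<close>, this family turns the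
        hypothesis on \<open>insert k I\<close> into the two-parameter identity required.\<close>
      have "(\<Sum>i\<in>insert k I. (if i = k then s else t * c i) * Z i) = s * Z k + t * (\<Sum>i\<in>I. c i * Z i)"
        for Z :: "'i \<Rightarrow> real"
      proof -
        have "(\<Sum>i\<in>I. (if i = k then s else t * c i) * Z i) = (\<Sum>i\<in>I. t * (c i * Z i))"
          using insert.hyps(2) by (intro sum.cong) auto
        then show ?thesis
          using insert.hyps by (simp add: sum_distrib_left)
      qed
      then show "(\<integral>x. iexp (s * Y k x + t * (\<Sum>i\<in>I. c i * Y i x)) \<partial>M) =
          (\<integral>x. iexp (s * Y' k x + t * (\<Sum>i\<in>I. c i * Y' i x)) \<partial>N)"
        using insert.prems(5)[of "\<lambda>i. if i = k then s else t * c i"] by simp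
    qed measurable
    have "(\<integral>x. iexp (\<Sum>i\<in>I. c i * Y i x) \<partial>M') =
        (\<integral>x. indicator (A k) (Y k x) *\<^sub>R iexp (\<Sum>i\<in>I. c i * Y i x) \<partial>M)"
      unfolding M'_def ennreal_indicator[symmetric]
      by (subst integral_density) (auto intro!: Bochner_Integration.integral_cong simp: indicator_def)
    moreover have "(\<integral>x. iexp (\<Sum>i\<in>I. c i * Y' i x) \<partial>N') =
        (\<integral>x. indicator (A k) (Y' k x) *\<^sub>R iexp (\<Sum>i\<in>I. c i * Y' i x) \<partial>N)"
      unfolding N'_def ennreal_indicator[symmetric]
      by (subst integral_density) (auto intro!: Bochner_Integration.integral_cong simp: indicator_def)
    ultimately show "(\<integral>x. iexp (\<Sum>i\<in>I. c i * Y i x) \<partial>M') = (\<integral>x. iexp (\<Sum>i\<in>I. c i * Y' i x) \<partial>N')"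
      using ch by simp
  qed (use insert.prems(6) Y in \<open>auto simp: M'_def N'_def\<close>)
  moreover have "measure M' {x\<in>space M'. \<forall>i\<in>I. Y i x \<in> A i} = measure M {x\<in>space M. \<forall>i\<in>insert k I. Y i x \<in> A i}"
    using box(1) S(1) unfolding M'_def
    by (simp add: Sigma_Algebra.measure_def emeasure_restricted) (auto intro!: arg_cong[where f = "\<lambda>A. enn2real (emeasure M A)"])
  moreover have "measure N' {x\<in>space N'. \<forall>i\<in>I. Y' i x \<in> A i} = measure N {x\<in>space N. \<forall>i\<in>insert k I. Y' i x \<in> A i}"
    using box(2) S(2) unfolding N'_def
    by (simp add: Sigma_Algebra.measure_def emeasure_restricted) (auto intro!: arg_cong[where f = "\<lambda>A. enn2real (emeasure N A)"])
  ultimately show ?case by simp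
qed

section \<open>Normal random variables, possibly of variance zero\<close>

text \<open>Adds mean and variance to the two alternatives of \<open>normal_rv\<close>. The variance
  is 0 in the first and positive in the second, so it tells them apart.\<close>

lemma normal_rv_cases:
  assumes "prob_space M" "normal_rv M X"
  obtains
    (degenerate) m where "AE \<omega> in M. X \<omega> = m" "integral\<^sup>L M X = m"
      "(\<integral>\<omega>. (X \<omega> - integral\<^sup>L M X)\<^sup>2 \<partial>M) = 0"
  | (density) m \<sigma> where "\<sigma> > 0" "distributed M lborel X (normal_density m \<sigma>)" "integral\<^sup>L M X = m"
      "(\<integral>\<omega>. (X \<omega> - integral\<^sup>L M X)\<^sup>2 \<partial>M) = \<sigma>\<^sup>2"
proof -
  interpret prob_space M by fact
  have [measurable]: "X \<in> borel_measurable M"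
    using assms(2) by (simp add: normal_rv_def)
  from assms(2) consider m where "AE \<omega> in M. X \<omega> = m"
    | m \<sigma> where "\<sigma> > 0" "distributed M lborel X (normal_density m \<sigma>)"
    by (auto simp: normal_rv_def)
  then show ?thesis
  proof cases
    case (1 m)
    have "integral\<^sup>L M X = (\<integral>\<omega>. m \<partial>M)"
      using 1 by (intro integral_cong_AE) auto
    then have m: "integral\<^sup>L M X = m"
      by (simp add: prob_space)
    have "(\<integral>\<omega>. (X \<omega> - m)\<^sup>2 \<partial>M) = (\<integral>\<omega>. 0 \<partial>M)"
      using 1 by (intro integral_cong_AE) auto
    then show ?thesis
      using degenerate 1 m by simp
  next
    case (2 m \<sigma>)
    show ?thesis
      by (rule density[OF 2 normal_distributed_expectation[OF 2] normal_distributed_variance[OF 2]])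
  qed
qed

lemma normal_rv_square_integrable:
  assumes "prob_space M" "normal_rv M X"
  shows "integrable M X" "integrable M (\<lambda>\<omega>. (X \<omega>)\<^sup>2)"
proof -
  interpret prob_space M by fact
  have [measurable]: "X \<in> borel_measurable M"
    using assms(2) by (simp add: normal_rv_def)
  have sq: "integrable M (\<lambda>\<omega>. (X \<omega>)\<^sup>2)"
    using assms
  proof (cases rule: normal_rv_cases)
    case (degenerate m)
    from degenerate(1) have "AE \<omega> in M. m\<^sup>2 = (X \<omega>)\<^sup>2"
      by eventually_elim simp
    then show ?thesis
      by (rule integrable_cong_AE_imp[rotated 2]) auto
  next
    case (density m \<sigma>)
    have "integrable M (\<lambda>\<omega>. (X \<omega> - m) ^ k)" for k
      using distributed_integrable[OF density(2), of "\<lambda>x. (x - m) ^ k"]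
        integrable_normal_moment[OF density(1), of m k] by simp
    \<comment> \<open>Only centred moments are at hand; the sum is the expansion of the raw square
      around \<open>m\<close>.\<close>
    from this[of 2] this[of 1] have "integrable M (\<lambda>\<omega>. (X \<omega> - m)\<^sup>2 + 2 * m * (X \<omega> - m) + m\<^sup>2)"
      by (intro Bochner_Integration.integrable_add integrable_mult_right) auto
    then show ?thesis
      by (simp add: power2_eq_square algebra_simps)
  qed
  then show "integrable M (\<lambda>\<omega>. (X \<omega>)\<^sup>2)" .
  show "integrable M X"
    using sq by (rule square_integrable_imp_integrable[rotated]) simp
qed

text \<open>Equal variances exclude the mixed cases. What remains is two point masses at the common
  mean, or two normal densities whose positive standard deviations agree because their squares
  do.\<close>

lemma normal_rv_distr_eq:
  assumes M: "prob_space M" "normal_rv M X" and N: "prob_space N" "normal_rv N Y"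
    and mean: "integral\<^sup>L M X = integral\<^sup>L N Y"
    and var: "(\<integral>\<omega>. (X \<omega> - integral\<^sup>L M X)\<^sup>2 \<partial>M) = (\<integral>\<omega>. (Y \<omega> - integral\<^sup>L N Y)\<^sup>2 \<partial>N)"
  shows "distr M borel X = distr N borel Y"
proof -
  have const: "distr L borel Z = return borel m"
    if "prob_space L" "normal_rv L Z" "AE \<omega> in L. Z \<omega> = m" for L :: "'c measure" and Z m
  proof -
    have "distr L borel Z = distr L borel (\<lambda>_. m)"
      using that by (intro distr_cong_AE) (auto simp: normal_rv_def)
    then show ?thesis
      using that(1) by (simp add: prob_space.distr_const)
  qed
  have dens: "distr L borel Z = density lborel f"
    if "distributed L lborel Z f" for L :: "'c measure" and Z :: "'c \<Rightarrow> real" and f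
    using that by (metis distributed_distr_eq_density distr_cong sets_lborel)
  show ?thesis
    using M
  proof (cases rule: normal_rv_cases)
    case X: (degenerate m)
    from N show ?thesis
    proof (cases rule: normal_rv_cases)
      case (degenerate m')
      then show ?thesis
        using X const[OF M] const[OF N] mean by simp
    qed (use X var in auto)
  next
    case X: (density m \<sigma>)
    from N show ?thesis
    proof (cases rule: normal_rv_cases)
      case (density m' \<sigma>')
      then have "\<sigma>\<^sup>2 = \<sigma>'\<^sup>2"
        using X var by simp
      then have "\<sigma>' = \<sigma>"
        using X(1) density(1) by (simp add: power2_eq_iff_nonneg)
      then show ?thesis
        using X density dens[OF X(2)] dens[OF density(2)] mean by simp
    qed (use X var in auto)
  qed
qed

lemma normal_rv_diff_const:
  assumes "prob_space M" "normal_rv M X"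
  shows "normal_rv M (\<lambda>\<omega>. X \<omega> - c)"
proof -
  interpret prob_space M by fact
  from assms(2) consider m where "AE \<omega> in M. X \<omega> = m"
    | m \<sigma> where "\<sigma> > 0" "distributed M lborel X (normal_density m \<sigma>)"
    by (auto simp: normal_rv_def)
  then show ?thesis
  proof cases
    case (1 m)
    then have "AE \<omega> in M. X \<omega> - c = m - c"
      by eventually_elim simp
    then show ?thesis
      using assms(2) by (auto simp: normal_rv_def)
  next
    case (2 m \<sigma>)
    from normal_density_affine[OF this(2,1), of 1 "- c"]
    have "distributed M lborel (\<lambda>\<omega>. X \<omega> - c) (normal_density (m - c) \<sigma>)"
      by simp
    then show ?thesis
      using assms(2) 2(1) by (auto simp: normal_rv_def)
  qed
qed

section \<open>Moments of Gaussian processes\<close>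

text \<open>The product is dominated by the sum of the squares. This makes covariances of jointly
  normal coordinates genuine integrals instead of the default value 0 of a non-integrable
  function.\<close>

lemma square_integrable_imp_integrable_mult:
  fixes X Y :: "'a \<Rightarrow> real"
  assumes [measurable]: "X \<in> borel_measurable M" "Y \<in> borel_measurable M"
    and "integrable M (\<lambda>\<omega>. (X \<omega>)\<^sup>2)" "integrable M (\<lambda>\<omega>. (Y \<omega>)\<^sup>2)"
  shows "integrable M (\<lambda>\<omega>. X \<omega> * Y \<omega>)"
proof (rule Bochner_Integration.integrable_bound)
  show "integrable M (\<lambda>\<omega>. (X \<omega>)\<^sup>2 + (Y \<omega>)\<^sup>2)"
    using assms by auto
  have "\<bar>a * b\<bar> \<le> a\<^sup>2 + b\<^sup>2" for a b :: real
  proof -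
    have "2 * (\<bar>a\<bar> * \<bar>b\<bar>) \<le> a\<^sup>2 + b\<^sup>2" "0 \<le> \<bar>a\<bar> * \<bar>b\<bar>"
      using sum_squares_bound[of "\<bar>a\<bar>" "\<bar>b\<bar>"] by simp_all
    then show ?thesis
      unfolding abs_mult by linarith
  qed
  then show "AE \<omega> in M. norm (X \<omega> * Y \<omega>) \<le> norm ((X \<omega>)\<^sup>2 + (Y \<omega>)\<^sup>2)"
    by auto
qed simp

lemma integrable_vec_iff:
  fixes X :: "'a \<Rightarrow> real ^ 'd"
  shows "integrable M X \<longleftrightarrow> (\<forall>i. integrable M (\<lambda>\<omega>. X \<omega> $ i))"
proof
  assume "integrable M X"
  then show "\<forall>i. integrable M (\<lambda>\<omega>. X \<omega> $ i)"
    using integrable_bounded_linear[OF bounded_linear_vec_nth] by blast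
next
  assume "\<forall>i. integrable M (\<lambda>\<omega>. X \<omega> $ i)"
  then have "integrable M (\<lambda>\<omega>. \<Sum>i\<in>UNIV. (X \<omega> $ i) *\<^sub>R axis i (1 :: real))"
    by auto
  moreover have "(\<Sum>i\<in>UNIV. (v $ i) *\<^sub>R axis i (1 :: real)) = v" for v :: "real ^ 'd"
    using basis_expansion[of v] by (simp only: scalar_mult_eq_scaleR)
  ultimately show "integrable M X"
    by (simp only:)
qed

context
  fixes M :: "'a measure" and T :: "'i set" and X :: "'i \<Rightarrow> 'a \<Rightarrow> real ^ 'd"
  assumes gp: "gaussian_process M T X"
begin

lemma gaussian_process_measurable: "t \<in> T \<Longrightarrow> X t \<in> borel_measurable M"
  using gp unfolding gaussian_process_def jointly_gaussian_def
  by (metis empty_subsetI finite.emptyI finite_insert insertI1 insert_subset)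

lemma gaussian_process_linear_combination:
  "finite J \<Longrightarrow> J \<subseteq> T \<Longrightarrow> normal_rv M (\<lambda>\<omega>. \<Sum>t\<in>J. c t \<bullet> X t \<omega>)"
  using gp by (simp add: gaussian_process_def jointly_gaussian_def)

lemma gaussian_process_component:
  assumes "t \<in> T"
  shows "normal_rv M (\<lambda>\<omega>. X t \<omega> $ i)"
  using gaussian_process_linear_combination[of "{t}" "\<lambda>_. axis i 1"] assms
  by (simp add: inner_axis')

lemma gaussian_process_integrable:
  assumes "t \<in> T"
  shows "integrable M (X t)"
  using normal_rv_square_integrable(1) gaussian_process_component[OF assms] gp
  by (auto simp: integrable_vec_iff gaussian_process_def)

lemma gaussian_process_centered_product_integrable:
  assumes "s \<in> T" "t \<in> T"
  shows "integrable M (\<lambda>\<omega>. (X s \<omega> $ i - a) * (X t \<omega> $ j - b))"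
proof -
  have M: "prob_space M"
    using gp by (simp add: gaussian_process_def)
  note n = normal_rv_diff_const[OF M gaussian_process_component]
  show ?thesis
    using n[OF assms(1), of i a] n[OF assms(2), of j b] normal_rv_square_integrable(2)[OF M]
    by (intro square_integrable_imp_integrable_mult) (auto simp: normal_rv_def)
qed

lemma gaussian_process_mean_linear_combination:
  assumes "finite J" "J \<subseteq> T"
  shows "(\<integral>\<omega>. (\<Sum>t\<in>J. c t \<bullet> X t \<omega>) \<partial>M) = (\<Sum>t\<in>J. c t \<bullet> mean_vec M (X t))"
  using assms gaussian_process_integrable
  by (subst Bochner_Integration.integral_sum) (auto simp: mean_vec_def intro!: sum.cong)

text \<open>In centred coordinates \<open>d\<close> the difference is a single linear combination;
  its square expands over pairs of coordinates and is integrated term by term. Covariances between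
  different index points enter here.\<close>

lemma gaussian_process_variance_linear_combination:
  assumes J: "finite J" "J \<subseteq> T"
  shows "(\<integral>\<omega>. ((\<Sum>t\<in>J. c t \<bullet> X t \<omega>) - (\<Sum>t\<in>J. c t \<bullet> mean_vec M (X t)))\<^sup>2 \<partial>M) =
    (\<Sum>s\<in>J. \<Sum>t\<in>J. \<Sum>i\<in>UNIV. \<Sum>j\<in>UNIV. c s $ i * c t $ j * cov_mat M (X s) (X t) $ i $ j)"
proof -
  define d where "d t \<omega> i = X t \<omega> $ i - mean_vec M (X t) $ i" for t \<omega> i
  have "(\<Sum>t\<in>J. c t \<bullet> X t \<omega>) - (\<Sum>t\<in>J. c t \<bullet> mean_vec M (X t)) = (\<Sum>t\<in>J. \<Sum>i\<in>UNIV. c t $ i * d t \<omega> i)" for \<omega>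
    by (simp add: inner_vec_def d_def right_diff_distrib sum_subtractf)
  then have "((\<Sum>t\<in>J. c t \<bullet> X t \<omega>) - (\<Sum>t\<in>J. c t \<bullet> mean_vec M (X t)))\<^sup>2 =
      (\<Sum>s\<in>J. \<Sum>t\<in>J. \<Sum>i\<in>UNIV. \<Sum>j\<in>UNIV. c s $ i * c t $ j * (d s \<omega> i * d t \<omega> j))" for \<omega>
    by (simp add: power2_eq_square sum_product mult_ac)
  moreover have "(\<integral>\<omega>. d s \<omega> i * d t \<omega> j \<partial>M) = cov_mat M (X s) (X t) $ i $ j" for s t i j
    by (simp add: cov_mat_def d_def)
  moreover have "integrable M (\<lambda>\<omega>. d s \<omega> i * d t \<omega> j)" if "s \<in> J" "t \<in> J" for s t i j
    unfolding d_def using that J by (intro gaussian_process_centered_product_integrable) auto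
  ultimately show ?thesis
    by (simp add: Bochner_Integration.integral_sum)
qed

end

section \<open>Affine images\<close>

text \<open>The constant \<open>b\<close> shifts the mean and cancels after centring, so the
  variance depends on \<open>A\<close> alone. Assumption \<open>XX\<close> is applied with the
  coordinates of the mean as shifts.\<close>

lemma
  fixes A :: "real ^ 'n ^ 'q" and X :: "'a \<Rightarrow> real ^ 'n"
  assumes M: "prob_space M" and X: "integrable M X"
    and XX: "\<And>i j a b. integrable M (\<lambda>\<omega>. (X \<omega> $ i - a) * (X \<omega> $ j - b))"
  shows mean_vec_affine: "mean_vec M (\<lambda>\<omega>. A *v X \<omega> - b) = A *v mean_vec M X - b"
    and var_mat_affine: "var_mat M (\<lambda>\<omega>. A *v X \<omega> - b) = A ** var_mat M X ** transpose A"
proof -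
  interpret prob_space M by fact
  have AX: "integrable M (\<lambda>\<omega>. A *v X \<omega>)"
    by (intro integrable_bounded_linear[OF _ X] matrix_vector_mul_bounded_linear)
  show mean: "mean_vec M (\<lambda>\<omega>. A *v X \<omega> - b) = A *v mean_vec M X - b"
    unfolding mean_vec_def using AX
    by (simp add: prob_space integral_bounded_linear[OF matrix_vector_mul_bounded_linear X])
  define d where "d \<omega> k = X \<omega> $ k - mean_vec M X $ k" for \<omega> k
  have d: "(A *v X \<omega> - b) $ i - (A *v mean_vec M X - b) $ i = (\<Sum>k\<in>UNIV. A $ i $ k * d \<omega> k)" for \<omega> i
    by (simp add: matrix_vector_mult_def d_def right_diff_distrib sum_subtractf)
  have int: "integrable M (\<lambda>\<omega>. d \<omega> k * d \<omega> l)" for k l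
    unfolding d_def by (rule XX)
  show "var_mat M (\<lambda>\<omega>. A *v X \<omega> - b) = A ** var_mat M X ** transpose A"
  proof (rule vec_eq_iff[THEN iffD2], rule allI, rule vec_eq_iff[THEN iffD2], rule allI)
    fix i j
    have "var_mat M (\<lambda>\<omega>. A *v X \<omega> - b) $ i $ j =
        (\<integral>\<omega>. (\<Sum>k\<in>UNIV. \<Sum>l\<in>UNIV. A $ i $ k * A $ j $ l * (d \<omega> k * d \<omega> l)) \<partial>M)"
      unfolding cov_mat_def mean by (simp only: d sum_product vec_lambda_beta) (simp only: mult_ac)
    also have "\<dots> = (\<Sum>k\<in>UNIV. \<Sum>l\<in>UNIV. A $ i $ k * A $ j $ l * var_mat M X $ k $ l)"
      using int by (simp add: Bochner_Integration.integral_sum cov_mat_def d_def)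
    \<comment> \<open>In the matrix product the outer sum runs over the second index of the
      covariance, hence the exchange of sums.\<close>
    also have "\<dots> = (A ** var_mat M X ** transpose A) $ i $ j"
      by (subst sum.swap)
        (simp add: matrix_matrix_mult_def transpose_def sum_distrib_left sum_distrib_right mult_ac)
    finally show "var_mat M (\<lambda>\<omega>. A *v X \<omega> - b) $ i $ j = (A ** var_mat M X ** transpose A) $ i $ j" .
  qed
qed

text \<open>A combination of the images is, up to a constant, a combination of the original vectors
  with coefficients moved across by \<open>c t v* A t\<close>. The map \<open>\<pi>\<close> may fail
  to be injective: points \<open>(x, z, u)\<close> differing only in \<open>z\<close> use the same
  \<open>f (x, u)\<close>.\<close>

lemma gaussian_process_affine_image:
  fixes A :: "'k \<Rightarrow> real ^ 'n ^ 'q" and X :: "'i \<Rightarrow> 'a \<Rightarrow> real ^ 'n"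
  assumes gp: "gaussian_process M D X" and \<pi>: "\<And>t. t \<in> T \<Longrightarrow> \<pi> t \<in> D"
  shows "gaussian_process M T (\<lambda>t \<omega>. A t *v X (\<pi> t) \<omega> - b t)"
  unfolding gaussian_process_def jointly_gaussian_def
proof (intro conjI allI impI ballI; (elim conjE)?)
  show M: "prob_space M"
    using gp by (simp add: gaussian_process_def)
  fix J assume J: "finite J" "J \<subseteq> T"
  show "(\<lambda>\<omega>. A t *v X (\<pi> t) \<omega> - b t) \<in> borel_measurable M" if "t \<in> J" for t
  proof -
    have "X (\<pi> t) \<in> borel_measurable M"
      using that J \<pi> by (intro gaussian_process_measurable[OF gp]) auto
    then have "(\<lambda>\<omega>. A t *v X (\<pi> t) \<omega>) \<in> borel_measurable M"
      by (rule measurable_compose)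
        (intro borel_measurable_continuous_onI linear_continuous_on matrix_vector_mul_bounded_linear)
    then show ?thesis
      by simp
  qed
  fix c :: "'k \<Rightarrow> real ^ 'q"
  \<comment> \<open>Coefficients of all indices over the same point \<open>p\<close> are added up,
    so that the sum runs over the set \<open>\<pi>\<close> followed by \<open>J\<close>, without
    repetitions.\<close>
  define c' where "c' p = (\<Sum>t\<in>{t\<in>J. \<pi> t = p}. c t v* A t)" for p
  have "(\<Sum>t\<in>J. c t \<bullet> (A t *v X (\<pi> t) \<omega> - b t)) =
      (\<Sum>p\<in>\<pi> ` J. c' p \<bullet> X p \<omega>) - (\<Sum>t\<in>J. c t \<bullet> b t)" for \<omega>
  proof -
    have "(\<Sum>p\<in>\<pi> ` J. c' p \<bullet> X p \<omega>) = (\<Sum>p\<in>\<pi> ` J. \<Sum>t\<in>{t\<in>J. \<pi> t = p}. (c t v* A t) \<bullet> X (\<pi> t) \<omega>)"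
      by (simp add: c'_def inner_sum_left)
    also have "\<dots> = (\<Sum>t\<in>J. (c t v* A t) \<bullet> X (\<pi> t) \<omega>)"
      by (rule sum.image_gen[OF J(1), symmetric])
    finally show ?thesis
      by (simp add: dot_lmul_matrix inner_diff_right sum_subtractf)
  qed
  moreover have "normal_rv M (\<lambda>\<omega>. \<Sum>p\<in>\<pi> ` J. c' p \<bullet> X p \<omega>)"
    using J \<pi> by (intro gaussian_process_linear_combination[OF gp]) auto
  ultimately show "normal_rv M (\<lambda>\<omega>. \<Sum>t\<in>J. c t \<bullet> (A t *v X (\<pi> t) \<omega> - b t))"
    by (simp add: normal_rv_diff_const[OF M])
qed

section \<open>Finite-dimensional laws from mean and covariance\<close>

text \<open>The box lemma is about real-valued families, so the vectors are flattened by
  \<open>coords\<close> into scalars indexed by \<open>I\<close>. Boxes determine a finite measure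
  on the product space \<open>P\<close>, and \<open>join\<close> carries the equality back to
  vectors.\<close>

lemma fin_dim_law_eqI:
  fixes X :: "'i \<Rightarrow> 'a \<Rightarrow> real ^ 'd" and Y :: "'i \<Rightarrow> 'b \<Rightarrow> real ^ 'd"
  assumes J: "finite J"
    and M: "finite_measure M" "\<And>t. t \<in> J \<Longrightarrow> X t \<in> borel_measurable M"
    and N: "finite_measure N" "\<And>t. t \<in> J \<Longrightarrow> Y t \<in> borel_measurable N"
    and distr: "\<And>c. distr M borel (\<lambda>\<omega>. \<Sum>t\<in>J. c t \<bullet> X t \<omega>) = distr N borel (\<lambda>\<omega>. \<Sum>t\<in>J. c t \<bullet> Y t \<omega>)"
  shows "fin_dim_law M J X = fin_dim_law N J Y"
proof -
  define I :: "('i \<times> 'd) set" where "I = J \<times> UNIV"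
  define P where "P = (\<Pi>\<^sub>M p\<in>I. (borel :: real measure))"
  define coords :: "('i \<Rightarrow> real ^ 'd) \<Rightarrow> 'i \<times> 'd \<Rightarrow> real"
    where "coords x = (\<lambda>p\<in>I. x (fst p) $ snd p)" for x
  define join :: "('i \<times> 'd \<Rightarrow> real) \<Rightarrow> 'i \<Rightarrow> real ^ 'd"
    where "join w = (\<lambda>t\<in>J. \<chi> i. w (t, i))" for w
  have I: "finite I"
    using J by (simp add: I_def)
  have meas: "(\<lambda>\<omega>. Z (fst p) \<omega> $ snd p) \<in> borel_measurable L"
    if "\<And>t. t \<in> J \<Longrightarrow> Z t \<in> borel_measurable L" "p \<in> I"
    for L :: "'c measure" and Z :: "'i \<Rightarrow> 'c \<Rightarrow> real ^ 'd" and p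
  proof -
    have "Z (fst p) \<in> borel_measurable L"
      using that by (auto simp: I_def)
    then show ?thesis
      by (rule measurable_compose)
        (intro borel_measurable_continuous_onI continuous_intros)
  qed
  have coords[measurable]: "(\<lambda>\<omega>. coords (\<lambda>t. Z t \<omega>)) \<in> measurable L P"
    if "\<And>t. t \<in> J \<Longrightarrow> Z t \<in> borel_measurable L"
    for L :: "'c measure" and Z :: "'i \<Rightarrow> 'c \<Rightarrow> real ^ 'd"
    unfolding P_def coords_def by (intro measurable_restrict meas that)
  have join: "join \<in> measurable P (\<Pi>\<^sub>M t\<in>J. borel)"
    unfolding join_def
  proof (rule measurable_restrict)
    fix t assume t: "t \<in> J"
    have "(\<lambda>w. w (t, i)) \<in> borel_measurable P" for i
      unfolding P_def using t by (intro measurable_component_singleton) (simp add: I_def)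
    then have "(\<lambda>w. (\<chi> i. w (t, i)) \<bullet> b) \<in> borel_measurable P" if "b \<in> Basis" for b :: "real ^ 'd"
      by (simp add: inner_vec_def)
    then show "(\<lambda>w. \<chi> i. w (t, i)) \<in> borel_measurable P"
      by (subst borel_measurable_euclidean_space) blast
  qed
  \<comment> \<open>On \<open>J\<close>, \<open>join\<close> undoes \<open>coords\<close>, so the
    law of the vectors is an image of the law of the scalars.\<close>
  have law: "fin_dim_law L J Z = distr (distr L P (\<lambda>\<omega>. coords (\<lambda>t. Z t \<omega>))) (\<Pi>\<^sub>M t\<in>J. borel) join"
    if Z: "\<And>t. t \<in> J \<Longrightarrow> Z t \<in> borel_measurable L"
    for L :: "'c measure" and Z :: "'i \<Rightarrow> 'c \<Rightarrow> real ^ 'd"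
  proof -
    have "join (coords x) = (\<lambda>t\<in>J. x t)" for x
      by (auto simp: join_def coords_def I_def vec_eq_iff fun_eq_iff restrict_def)
    then show ?thesis
      unfolding fin_dim_law_def using coords[OF Z] join by (subst distr_distr) (auto simp: comp_def)
  qed
  have box: "emeasure (distr L P (\<lambda>\<omega>. coords (\<lambda>t. Z t \<omega>))) (Pi\<^sub>E I A) =
      ennreal (measure L {\<omega>\<in>space L. \<forall>p\<in>I. Z (fst p) \<omega> $ snd p \<in> A p})"
    if L: "finite_measure L" and Z: "\<And>t. t \<in> J \<Longrightarrow> Z t \<in> borel_measurable L"
      and A: "\<And>p. p \<in> I \<Longrightarrow> A p \<in> sets borel"
    for L :: "'c measure" and Z :: "'i \<Rightarrow> 'c \<Rightarrow> real ^ 'd" and A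
  proof -
    have "Pi\<^sub>E I A \<in> sets P"
      unfolding P_def using I A by (intro sets_PiM_I_finite) auto
    then have "emeasure (distr L P (\<lambda>\<omega>. coords (\<lambda>t. Z t \<omega>))) (Pi\<^sub>E I A) =
        emeasure L ((\<lambda>\<omega>. coords (\<lambda>t. Z t \<omega>)) -` Pi\<^sub>E I A \<inter> space L)"
      by (intro emeasure_distr coords Z)
    also have "(\<lambda>\<omega>. coords (\<lambda>t. Z t \<omega>)) -` Pi\<^sub>E I A \<inter> space L =
        {\<omega>\<in>space L. \<forall>p\<in>I. Z (fst p) \<omega> $ snd p \<in> A p}"
      by (rule set_eqI) (simp add: coords_def PiE_iff conj_commute)
    finally show ?thesis
      by (simp only: finite_measure.emeasure_eq_measure[OF L])
  qed
  \<comment> \<open>The scalar coefficients are regrouped into vectors \<open>C t\<close>; the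
    exponential integral then depends only on the law of one linear combination, where
    \<open>distr\<close> applies.\<close>
  have char: "(\<integral>\<omega>. iexp (\<Sum>p\<in>I. c p * X (fst p) \<omega> $ snd p) \<partial>M) =
      (\<integral>\<omega>. iexp (\<Sum>p\<in>I. c p * Y (fst p) \<omega> $ snd p) \<partial>N)" for c
  proof -
    define C where "C t = (\<chi> i. c (t, i))" for t
    have C: "(\<Sum>p\<in>I. c p * x (fst p) $ snd p) = (\<Sum>t\<in>J. C t \<bullet> x t)" for x :: "'i \<Rightarrow> real ^ 'd"
      by (simp add: I_def C_def inner_vec_def sum.cartesian_product case_prod_unfold)
    have "(\<integral>\<omega>. iexp (\<Sum>t\<in>J. C t \<bullet> Z t \<omega>) \<partial>L) = (\<integral>y. iexp y \<partial>distr L borel (\<lambda>\<omega>. \<Sum>t\<in>J. C t \<bullet> Z t \<omega>))"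
      if "\<And>t. t \<in> J \<Longrightarrow> Z t \<in> borel_measurable L" for L :: "'c measure" and Z :: "'i \<Rightarrow> 'c \<Rightarrow> real ^ 'd"
      using that by (subst integral_distr) (auto intro!: borel_measurable_sum)
    from this[OF M(2)] this[OF N(2)] show ?thesis
      using distr[of C] by (simp only: C[of "\<lambda>t. X t _"] C[of "\<lambda>t. Y t _"])
  qed
  have "distr M P (\<lambda>\<omega>. coords (\<lambda>t. X t \<omega>)) = distr N P (\<lambda>\<omega>. coords (\<lambda>t. Y t \<omega>))"
  proof (rule measure_eqI_PiM_finite)
    show "finite I" by (rule I)
    show "sets (distr M P (\<lambda>\<omega>. coords (\<lambda>t. X t \<omega>))) = sets (\<Pi>\<^sub>M p\<in>I. borel)"
      "sets (distr N P (\<lambda>\<omega>. coords (\<lambda>t. Y t \<omega>))) = sets (\<Pi>\<^sub>M p\<in>I. borel)"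
      by (simp_all add: P_def)
    show "emeasure (distr M P (\<lambda>\<omega>. coords (\<lambda>t. X t \<omega>))) (Pi\<^sub>E I A) =
        emeasure (distr N P (\<lambda>\<omega>. coords (\<lambda>t. Y t \<omega>))) (Pi\<^sub>E I A)"
      if A: "\<And>p. p \<in> I \<Longrightarrow> A p \<in> sets borel" for A
    proof -
      have "measure M {\<omega>\<in>space M. \<forall>p\<in>I. X (fst p) \<omega> $ snd p \<in> A p} =
          measure N {\<omega>\<in>space N. \<forall>p\<in>I. Y (fst p) \<omega> $ snd p \<in> A p}"
        using meas[OF M(2)] meas[OF N(2)] char A
        by (intro measure_box_eq_if_char_eq[OF I M(1) N(1),
              of "\<lambda>p \<omega>. X (fst p) \<omega> $ snd p" "\<lambda>p \<omega>. Y (fst p) \<omega> $ snd p"])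
      then show ?thesis
        using box[OF M A] box[OF N A] by simp
    qed
    \<comment> \<open>The whole space is itself a box of finite measure, so a constant sequence
      serves as the exhaustion.\<close>
    show "range (\<lambda>_ :: nat. Pi\<^sub>E I (\<lambda>_. UNIV)) \<subseteq> prod_algebra I (\<lambda>_. borel :: real measure)"
      using I by (auto intro!: prod_algebraI_finite)
    show "(\<Union>_ :: nat. Pi\<^sub>E I (\<lambda>_. UNIV)) = space (\<Pi>\<^sub>M p\<in>I. (borel :: real measure))"
      by (simp add: space_PiM)
    show "emeasure (distr M P (\<lambda>\<omega>. coords (\<lambda>t. X t \<omega>))) (Pi\<^sub>E I (\<lambda>_. UNIV)) \<noteq> \<infinity>"
      by (subst box[OF M]) auto
  qed
  then show ?thesis
    using law[OF M(2)] law[OF N(2)] by simp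
qed

text \<open>Every linear combination is normal, and its mean and variance are expressions in the
  mean vectors and covariances alone; so its law is the same on both sides.\<close>

lemma gaussian_process_fin_dim_law_eq:
  fixes X :: "'i \<Rightarrow> 'a \<Rightarrow> real ^ 'd" and Y :: "'i \<Rightarrow> 'b \<Rightarrow> real ^ 'd"
  assumes J: "finite J"
    and X: "gaussian_process M J X" and Y: "gaussian_process N J Y"
    and mean: "\<And>t. t \<in> J \<Longrightarrow> mean_vec M (X t) = mean_vec N (Y t)"
    and cov: "\<And>s t. s \<in> J \<Longrightarrow> t \<in> J \<Longrightarrow> cov_mat M (X s) (X t) = cov_mat N (Y s) (Y t)"
  shows "fin_dim_law M J X = fin_dim_law N J Y"
proof (rule fin_dim_law_eqI[OF J])
  have M: "prob_space M" and N: "prob_space N"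
    using X Y by (auto simp: gaussian_process_def)
  then show "finite_measure M" "finite_measure N"
    by (auto intro: prob_space.finite_measure)
  show "X t \<in> borel_measurable M" "Y t \<in> borel_measurable N" if "t \<in> J" for t
    using that gaussian_process_measurable[OF X] gaussian_process_measurable[OF Y] by auto
  show "distr M borel (\<lambda>\<omega>. \<Sum>t\<in>J. c t \<bullet> X t \<omega>) = distr N borel (\<lambda>\<omega>. \<Sum>t\<in>J. c t \<bullet> Y t \<omega>)" for c
  proof (rule normal_rv_distr_eq[OF M _ N])
    show "normal_rv M (\<lambda>\<omega>. \<Sum>t\<in>J. c t \<bullet> X t \<omega>)" "normal_rv N (\<lambda>\<omega>. \<Sum>t\<in>J. c t \<bullet> Y t \<omega>)"
      using gaussian_process_linear_combination[OF X J] gaussian_process_linear_combination[OF Y J]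
      by auto
    note means = gaussian_process_mean_linear_combination[OF X J order.refl]
      gaussian_process_mean_linear_combination[OF Y J order.refl]
    show "(\<integral>\<omega>. (\<Sum>t\<in>J. c t \<bullet> X t \<omega>) \<partial>M) = (\<integral>\<omega>. (\<Sum>t\<in>J. c t \<bullet> Y t \<omega>) \<partial>N)"
      unfolding means using mean by (intro sum.cong) auto
    show "(\<integral>\<omega>. ((\<Sum>t\<in>J. c t \<bullet> X t \<omega>) - (\<integral>\<omega>. (\<Sum>t\<in>J. c t \<bullet> X t \<omega>) \<partial>M))\<^sup>2 \<partial>M) =
        (\<integral>\<omega>. ((\<Sum>t\<in>J. c t \<bullet> Y t \<omega>) - (\<integral>\<omega>. (\<Sum>t\<in>J. c t \<bullet> Y t \<omega>) \<partial>N))\<^sup>2 \<partial>N)"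
      unfolding means gaussian_process_variance_linear_combination[OF X J order.refl]
        gaussian_process_variance_linear_combination[OF Y J order.refl]
      using cov by (intro sum.cong) auto
  qed
qed

section \<open>The barrier states dynamics\<close>

text \<open>At a fixed point the barrier matrix and the decay term are deterministic, so
  \<open>fz\<close> is an affine image of \<open>f\<close>. Being completely defined is expressed as
  uniqueness of finite-dimensional laws, and the comparison includes covariances between different
  points, because variances at single points do not fix joint laws.\<close>

theorem lemma1:
  fixes \<X> :: "(real ^ 'n) set" and \<U> :: "(real ^ 'm) set"
    and B :: "'q::finite \<Rightarrow> real \<Rightarrow> real" and h :: "'q \<Rightarrow> real ^ 'n \<Rightarrow> real" and \<gamma> :: "'q \<Rightarrow> real"
    and M :: "'a measure" and f :: "(real ^ 'n) \<times> (real ^ 'm) \<Rightarrow> 'a \<Rightarrow> real ^ 'n"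
    and K :: "(real ^ 'n) \<times> (real ^ 'm) \<Rightarrow> (real ^ 'n) \<times> (real ^ 'm) \<Rightarrow> real ^ 'n ^ 'n"
    and X :: "'d::finite \<Rightarrow> (real ^ 'n) \<times> (real ^ 'm)" and F :: "'d \<Rightarrow> real ^ 'n" and \<sigma>\<^sub>n :: real
  assumes origin: "0 \<in> \<X>" "\<And>j. h j 0 > 0"
    and h: "\<And>j. continuously_differentiable_near \<X> (h j)"
    and B: "\<And>j. barrier_function (B j)"
    and \<gamma>: "\<And>j. \<gamma> j \<ge> 0"
    and f: "gp_posterior_model M (\<X> \<times> \<U>) K X F \<sigma>\<^sub>n f"
  defines "fz \<equiv> barrier_dynamics B h \<gamma> f"
    and "T \<equiv> barrier_domain \<X> \<U> B h"
  shows "gaussian_process M T fz \<and>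
    (\<forall>(N :: 'b measure) g J.
       finite J \<and> J \<subseteq> T \<and> gaussian_process N J g \<and>
       (\<forall>t\<in>J. mean_vec N (g t) = mean_vec M (fz t)) \<and>
       (\<forall>s\<in>J. \<forall>t\<in>J. cov_mat N (g s) (g t) = cov_mat M (fz s) (fz t)) \<longrightarrow>
       fin_dim_law N J g = fin_dim_law M J fz) \<and>
    (\<forall>(x, z, u)\<in>T.
       mean_vec M (fz (x, z, u)) =
         barrier_matrix B h x z *v mean_vec M (f (x, u)) - barrier_decay B h \<gamma> x z \<and>
       var_mat M (fz (x, z, u)) =
         barrier_matrix B h x z ** var_mat M (f (x, u)) ** transpose (barrier_matrix B h x z))"
proof (intro conjI allI impI)
  have gp: "gaussian_process M (\<X> \<times> \<U>) f"
    using f by (simp add: gp_posterior_model_def)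
  \<comment> \<open>The form needed for the affine image lemma, with \<open>(x, z, u)\<close> sent
    to \<open>(x, u)\<close>.\<close>
  have fz: "fz = (\<lambda>t \<omega>. barrier_matrix B h (fst t) (fst (snd t)) *v f (fst t, snd (snd t)) \<omega>
      - barrier_decay B h \<gamma> (fst t) (fst (snd t)))"
    by (simp add: fz_def barrier_dynamics_def case_prod_unfold fun_eq_iff)
  have T: "(fst t, snd (snd t)) \<in> \<X> \<times> \<U>" if "t \<in> T" for t
    using that by (auto simp: T_def barrier_domain_def)
  show gpz: "gaussian_process M T fz"
    unfolding fz by (rule gaussian_process_affine_image[OF gp T])
  show "fin_dim_law N J g = fin_dim_law M J fz"
    if "finite J \<and> J \<subseteq> T \<and> gaussian_process N J g \<and>
       (\<forall>t\<in>J. mean_vec N (g t) = mean_vec M (fz t)) \<and>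
       (\<forall>s\<in>J. \<forall>t\<in>J. cov_mat N (g s) (g t) = cov_mat M (fz s) (fz t))"
    for N :: "'b measure" and g J
  proof (rule gaussian_process_fin_dim_law_eq)
    \<comment> \<open>Finite subsets of \<open>J\<close> are finite subsets of \<open>T\<close>, so
      the property passes to \<open>J\<close>.\<close>
    show "gaussian_process M J fz"
      using gpz that by (meson gaussian_process_def subset_trans)
  qed (use that in auto)
  have M: "prob_space M"
    using gp by (simp add: gaussian_process_def)
  show "\<forall>(x, z, u)\<in>T.
       mean_vec M (fz (x, z, u)) =
         barrier_matrix B h x z *v mean_vec M (f (x, u)) - barrier_decay B h \<gamma> x z \<and>
       var_mat M (fz (x, z, u)) =
         barrier_matrix B h x z ** var_mat M (f (x, u)) ** transpose (barrier_matrix B h x z)"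
  proof clarify
    fix x z u assume "(x, z, u) \<in> T"
    from T[OF this] have xu: "(x, u) \<in> \<X> \<times> \<U>"
      by simp
    have eq: "fz (x, z, u) = (\<lambda>\<omega>. barrier_matrix B h x z *v f (x, u) \<omega> - barrier_decay B h \<gamma> x z)"
      by (simp add: fz)
    note affine = M gaussian_process_integrable[OF gp xu]
      gaussian_process_centered_product_integrable[OF gp xu xu]
    show "mean_vec M (fz (x, z, u)) =
         barrier_matrix B h x z *v mean_vec M (f (x, u)) - barrier_decay B h \<gamma> x z \<and>
       var_mat M (fz (x, z, u)) =
         barrier_matrix B h x z ** var_mat M (f (x, u)) ** transpose (barrier_matrix B h x z)"
      unfolding eq using mean_vec_affine[OF affine] var_mat_affine[OF affine] by blast
  qed
qed

end
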